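(* Let $\mathscr U$ be an ultrafilter on $\mathbb N$ and let $\{F_i:\mathcal C_i\to\mathcal D_i\}_{i\in\mathbb N}$ be a sequence of functors between small categories. The map $F$ given on objects by $F([X_i])=[F_i(X_i)]$ and on morphisms by $F([f_i])=[F_i(f_i)]$ is a well-defined functor $$F=\prod_{\mathscr U}F_i:\prod_{\mathscr U}\mathcal C_i\to\prod_{\mathscr U}\mathcal D_i.$$ If for $\mathscr U$-almost every $i$ the functor $F_i$ is monoidal with tensor structure $J_i:F_i(-\otimes-)\xrightarrow{\sim}F_i(-)\otimes F_i(-)$, then $J=\operatorname{ulim}_iJ_i$ is a tensor structure for $F$. If $F_i$ is braided for $\mathscr U$-almost every $i$, then so is $F$.
   Context: For a sequence of sets $A_i$, two sequences $(a_i),(a_i')\in\prod_iA_i$ are $\mathscr U$-equivalent if $\{i\in\mathbb N\mid a_i=a_i'\}\in\mathscr U$; $\prod_{\mathscr U}A_i$ is the quotient set, and the class of $(a_i)$ is written $[a_i]$ or $\operatorname{ulim}_ia_i$. A statement holds "for $\mathscr U$-almost every $i$" if the set of $i$ for which it holds belongs to $\mathscr U$. The ultraproduct $\prod_{\mathscr U}\mathcal C_i$ of small categories has as objects and morphisms the classes of sequences of objects and morphisms, with source, target, composition and any monoidal or braided structure (which exists if it does for $\mathscr U$-almost every factor) defined termwise. $J=\operatorname{ulim}_iJ_i$ means $J_{[X_i],[Y_i]}=[(J_i)_{X_i,Y_i}]$. *)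

theory Defs
  imports Complex_Main
begin

section \<open>Categories and functors\<close>

text \<open>A small category is given by carrier sets of objects and morphisms; the operations are
  meaningful on the carriers (and \<open>g \<cdot>\<^bsub>C\<^esub> f\<close> for \<open>Dom C g = Cod C f\<close>) only.\<close>

record ('o, 'm) cat_data =
  Obj :: "'o set"
  Mor :: "'m set"
  Dom :: "'m \<Rightarrow> 'o"
  Cod :: "'m \<Rightarrow> 'o"
  Ident :: "'o \<Rightarrow> 'm"
  Comp :: "'m \<Rightarrow> 'm \<Rightarrow> 'm"  (infixr "\<cdot>\<index>" 55)

definition Hom :: "('o, 'm) cat_data \<Rightarrow> 'o \<Rightarrow> 'o \<Rightarrow> 'm set" where
  "Hom C X Y = {f \<in> Mor C. Dom C f = X \<and> Cod C f = Y}"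

locale category =
  fixes C :: "('o, 'm) cat_data"
  assumes Dom_in: "f \<in> Mor C \<Longrightarrow> Dom C f \<in> Obj C"
    and Cod_in: "f \<in> Mor C \<Longrightarrow> Cod C f \<in> Obj C"
    and Ident_in: "X \<in> Obj C \<Longrightarrow> Ident C X \<in> Hom C X X"
    and Comp_in: "f \<in> Hom C X Y \<Longrightarrow> g \<in> Hom C Y Z \<Longrightarrow> g \<cdot>\<^bsub>C\<^esub> f \<in> Hom C X Z"
    and Ident_Comp: "f \<in> Hom C X Y \<Longrightarrow> Ident C Y \<cdot>\<^bsub>C\<^esub> f = f"
    and Comp_Ident: "f \<in> Hom C X Y \<Longrightarrow> f \<cdot>\<^bsub>C\<^esub> Ident C X = f"
    and Comp_assoc: "f \<in> Hom C W X \<Longrightarrow> g \<in> Hom C X Y \<Longrightarrow> h \<in> Hom C Y Z \<Longrightarrow>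
      (h \<cdot>\<^bsub>C\<^esub> g) \<cdot>\<^bsub>C\<^esub> f = h \<cdot>\<^bsub>C\<^esub> (g \<cdot>\<^bsub>C\<^esub> f)"

definition inverse_mor :: "('o, 'm) cat_data \<Rightarrow> 'm \<Rightarrow> 'm \<Rightarrow> bool" where
  "inverse_mor C f g \<longleftrightarrow> f \<in> Mor C \<and> g \<in> Hom C (Cod C f) (Dom C f) \<and>
     g \<cdot>\<^bsub>C\<^esub> f = Ident C (Dom C f) \<and> f \<cdot>\<^bsub>C\<^esub> g = Ident C (Cod C f)"

definition Isos :: "('o, 'm) cat_data \<Rightarrow> 'o \<Rightarrow> 'o \<Rightarrow> 'm set" where
  "Isos C X Y = {f \<in> Hom C X Y. \<exists>g. inverse_mor C f g}"

definition inv_mor :: "('o, 'm) cat_data \<Rightarrow> 'm \<Rightarrow> 'm" where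
  "inv_mor C f = (THE g. inverse_mor C f g)"

record ('o1, 'm1, 'o2, 'm2) functor_data =
  FObj :: "'o1 \<Rightarrow> 'o2"
  FMor :: "'m1 \<Rightarrow> 'm2"

locale cat_functor = C: category C + D: category D
  for C :: "('o1, 'm1) cat_data" and D :: "('o2, 'm2) cat_data" +
  fixes F :: "('o1, 'm1, 'o2, 'm2) functor_data"
  assumes FObj_in: "X \<in> Obj C \<Longrightarrow> FObj F X \<in> Obj D"
    and FMor_in: "f \<in> Hom C X Y \<Longrightarrow> FMor F f \<in> Hom D (FObj F X) (FObj F Y)"
    and FMor_Ident: "X \<in> Obj C \<Longrightarrow> FMor F (Ident C X) = Ident D (FObj F X)"
    and FMor_Comp: "f \<in> Hom C X Y \<Longrightarrow> g \<in> Hom C Y Z \<Longrightarrow>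
      FMor F (g \<cdot>\<^bsub>C\<^esub> f) = FMor F g \<cdot>\<^bsub>D\<^esub> FMor F f"


section \<open>Monoidal and braided structures\<close>

text \<open>\<open>X \<otimes>\<^bsub>M\<^esub> Y\<close> is the tensor product of objects, \<open>f \<boxtimes>\<^bsub>M\<^esub> g\<close> that of morphisms.\<close>

record ('o, 'm) tensor_data =
  TObj :: "'o \<Rightarrow> 'o \<Rightarrow> 'o"  (infixl "\<otimes>\<index>" 70)
  TMor :: "'m \<Rightarrow> 'm \<Rightarrow> 'm"  (infixl "\<boxtimes>\<index>" 70)
  TUnit :: "'o"  ("\<one>\<index>")
  Assoc :: "'o \<Rightarrow> 'o \<Rightarrow> 'o \<Rightarrow> 'm"
  LUnit :: "'o \<Rightarrow> 'm"
  RUnit :: "'o \<Rightarrow> 'm"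

locale monoidal_category = category C
  for C :: "('o, 'm) cat_data" +
  fixes M :: "('o, 'm) tensor_data"
  assumes TObj_in: "X \<in> Obj C \<Longrightarrow> Y \<in> Obj C \<Longrightarrow> X \<otimes>\<^bsub>M\<^esub> Y \<in> Obj C"
    and TMor_in: "f \<in> Hom C X X' \<Longrightarrow> g \<in> Hom C Y Y' \<Longrightarrow>
      f \<boxtimes>\<^bsub>M\<^esub> g \<in> Hom C (X \<otimes>\<^bsub>M\<^esub> Y) (X' \<otimes>\<^bsub>M\<^esub> Y')"
    and TMor_Ident: "X \<in> Obj C \<Longrightarrow> Y \<in> Obj C \<Longrightarrow>
      Ident C X \<boxtimes>\<^bsub>M\<^esub> Ident C Y = Ident C (X \<otimes>\<^bsub>M\<^esub> Y)"
    and TMor_Comp: "f \<in> Hom C X X' \<Longrightarrow> f' \<in> Hom C X' X'' \<Longrightarrow> g \<in> Hom C Y Y' \<Longrightarrow> g' \<in> Hom C Y' Y'' \<Longrightarrow>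
      (f' \<cdot>\<^bsub>C\<^esub> f) \<boxtimes>\<^bsub>M\<^esub> (g' \<cdot>\<^bsub>C\<^esub> g) = (f' \<boxtimes>\<^bsub>M\<^esub> g') \<cdot>\<^bsub>C\<^esub> (f \<boxtimes>\<^bsub>M\<^esub> g)"
    and TUnit_in: "\<one>\<^bsub>M\<^esub> \<in> Obj C"
    and Assoc_iso: "X \<in> Obj C \<Longrightarrow> Y \<in> Obj C \<Longrightarrow> Z \<in> Obj C \<Longrightarrow>
      Assoc M X Y Z \<in> Isos C ((X \<otimes>\<^bsub>M\<^esub> Y) \<otimes>\<^bsub>M\<^esub> Z) (X \<otimes>\<^bsub>M\<^esub> (Y \<otimes>\<^bsub>M\<^esub> Z))"
    and Assoc_natural: "f \<in> Hom C X X' \<Longrightarrow> g \<in> Hom C Y Y' \<Longrightarrow> h \<in> Hom C Z Z' \<Longrightarrow>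
      Assoc M X' Y' Z' \<cdot>\<^bsub>C\<^esub> ((f \<boxtimes>\<^bsub>M\<^esub> g) \<boxtimes>\<^bsub>M\<^esub> h) =
      (f \<boxtimes>\<^bsub>M\<^esub> (g \<boxtimes>\<^bsub>M\<^esub> h)) \<cdot>\<^bsub>C\<^esub> Assoc M X Y Z"
    and LUnit_iso: "X \<in> Obj C \<Longrightarrow> LUnit M X \<in> Isos C (\<one>\<^bsub>M\<^esub> \<otimes>\<^bsub>M\<^esub> X) X"
    and LUnit_natural: "f \<in> Hom C X X' \<Longrightarrow>
      LUnit M X' \<cdot>\<^bsub>C\<^esub> (Ident C \<one>\<^bsub>M\<^esub> \<boxtimes>\<^bsub>M\<^esub> f) = f \<cdot>\<^bsub>C\<^esub> LUnit M X"
    and RUnit_iso: "X \<in> Obj C \<Longrightarrow> RUnit M X \<in> Isos C (X \<otimes>\<^bsub>M\<^esub> \<one>\<^bsub>M\<^esub>) X"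
    and RUnit_natural: "f \<in> Hom C X X' \<Longrightarrow>
      RUnit M X' \<cdot>\<^bsub>C\<^esub> (f \<boxtimes>\<^bsub>M\<^esub> Ident C \<one>\<^bsub>M\<^esub>) = f \<cdot>\<^bsub>C\<^esub> RUnit M X"
    and pentagon: "W \<in> Obj C \<Longrightarrow> X \<in> Obj C \<Longrightarrow> Y \<in> Obj C \<Longrightarrow> Z \<in> Obj C \<Longrightarrow>
      Assoc M W X (Y \<otimes>\<^bsub>M\<^esub> Z) \<cdot>\<^bsub>C\<^esub> Assoc M (W \<otimes>\<^bsub>M\<^esub> X) Y Z =
      (Ident C W \<boxtimes>\<^bsub>M\<^esub> Assoc M X Y Z) \<cdot>\<^bsub>C\<^esub> Assoc M W (X \<otimes>\<^bsub>M\<^esub> Y) Z \<cdot>\<^bsub>C\<^esub>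
        (Assoc M W X Y \<boxtimes>\<^bsub>M\<^esub> Ident C Z)"
    and triangle: "X \<in> Obj C \<Longrightarrow> Y \<in> Obj C \<Longrightarrow>
      (Ident C X \<boxtimes>\<^bsub>M\<^esub> LUnit M Y) \<cdot>\<^bsub>C\<^esub> Assoc M X \<one>\<^bsub>M\<^esub> Y = RUnit M X \<boxtimes>\<^bsub>M\<^esub> Ident C Y"

locale braided_category = monoidal_category C M
  for C :: "('o, 'm) cat_data" and M :: "('o, 'm) tensor_data" +
  fixes c :: "'o \<Rightarrow> 'o \<Rightarrow> 'm"
  assumes braiding_iso: "X \<in> Obj C \<Longrightarrow> Y \<in> Obj C \<Longrightarrow>
      c X Y \<in> Isos C (X \<otimes>\<^bsub>M\<^esub> Y) (Y \<otimes>\<^bsub>M\<^esub> X)"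
    and braiding_natural: "f \<in> Hom C X X' \<Longrightarrow> g \<in> Hom C Y Y' \<Longrightarrow>
      c X' Y' \<cdot>\<^bsub>C\<^esub> (f \<boxtimes>\<^bsub>M\<^esub> g) = (g \<boxtimes>\<^bsub>M\<^esub> f) \<cdot>\<^bsub>C\<^esub> c X Y"
    and hexagon1: "X \<in> Obj C \<Longrightarrow> Y \<in> Obj C \<Longrightarrow> Z \<in> Obj C \<Longrightarrow>
      Assoc M Y Z X \<cdot>\<^bsub>C\<^esub> c X (Y \<otimes>\<^bsub>M\<^esub> Z) \<cdot>\<^bsub>C\<^esub> Assoc M X Y Z =
      (Ident C Y \<boxtimes>\<^bsub>M\<^esub> c X Z) \<cdot>\<^bsub>C\<^esub> Assoc M Y X Z \<cdot>\<^bsub>C\<^esub> (c X Y \<boxtimes>\<^bsub>M\<^esub> Ident C Z)"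
    and hexagon2: "X \<in> Obj C \<Longrightarrow> Y \<in> Obj C \<Longrightarrow> Z \<in> Obj C \<Longrightarrow>
      inv_mor C (Assoc M Z X Y) \<cdot>\<^bsub>C\<^esub> c (X \<otimes>\<^bsub>M\<^esub> Y) Z \<cdot>\<^bsub>C\<^esub> inv_mor C (Assoc M X Y Z) =
      (c X Z \<boxtimes>\<^bsub>M\<^esub> Ident C Y) \<cdot>\<^bsub>C\<^esub> inv_mor C (Assoc M X Z Y) \<cdot>\<^bsub>C\<^esub> (Ident C X \<boxtimes>\<^bsub>M\<^esub> c Y Z)"

text \<open>A tensor structure on \<open>F\<close> is a natural isomorphism
  \<open>J\<^bsub>X,Y\<^esub> : F(X \<otimes> Y) \<rightarrow> F(X) \<otimes> F(Y)\<close> compatible with the associators, where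
  moreover \<open>F(\<one>) \<cong> \<one>\<close>. As in Etingof--Gelaki--Nikshych--Ostrik, Tensor Categories, Def. 2.4.1,
  the isomorphism \<open>F(\<one>) \<cong> \<one>\<close> is not part of the data (a coherent one is then determined by \<open>J\<close>).\<close>

locale monoidal_functor =
  cat_functor C D F + C: monoidal_category C M + D: monoidal_category D N
  for C :: "('o1, 'm1) cat_data" and M :: "('o1, 'm1) tensor_data"
    and D :: "('o2, 'm2) cat_data" and N :: "('o2, 'm2) tensor_data"
    and F :: "('o1, 'm1, 'o2, 'm2) functor_data" +
  fixes J :: "'o1 \<Rightarrow> 'o1 \<Rightarrow> 'm2"
  assumes J_iso: "X \<in> Obj C \<Longrightarrow> Y \<in> Obj C \<Longrightarrow>
      J X Y \<in> Isos D (FObj F (X \<otimes>\<^bsub>M\<^esub> Y)) (FObj F X \<otimes>\<^bsub>N\<^esub> FObj F Y)"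
    and J_natural: "f \<in> Hom C X X' \<Longrightarrow> g \<in> Hom C Y Y' \<Longrightarrow>
      J X' Y' \<cdot>\<^bsub>D\<^esub> FMor F (f \<boxtimes>\<^bsub>M\<^esub> g) = (FMor F f \<boxtimes>\<^bsub>N\<^esub> FMor F g) \<cdot>\<^bsub>D\<^esub> J X Y"
    and J_assoc: "X \<in> Obj C \<Longrightarrow> Y \<in> Obj C \<Longrightarrow> Z \<in> Obj C \<Longrightarrow>
      Assoc N (FObj F X) (FObj F Y) (FObj F Z) \<cdot>\<^bsub>D\<^esub>
        (J X Y \<boxtimes>\<^bsub>N\<^esub> Ident D (FObj F Z)) \<cdot>\<^bsub>D\<^esub> J (X \<otimes>\<^bsub>M\<^esub> Y) Z =
      (Ident D (FObj F X) \<boxtimes>\<^bsub>N\<^esub> J Y Z) \<cdot>\<^bsub>D\<^esub> J X (Y \<otimes>\<^bsub>M\<^esub> Z) \<cdot>\<^bsub>D\<^esub> FMor F (Assoc M X Y Z)"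
    and F_unit: "Isos D (FObj F \<one>\<^bsub>M\<^esub>) \<one>\<^bsub>N\<^esub> \<noteq> {}"

locale braided_functor =
  monoidal_functor C M D N F J + C: braided_category C M c + D: braided_category D N d
  for C :: "('o1, 'm1) cat_data" and M :: "('o1, 'm1) tensor_data" and c :: "'o1 \<Rightarrow> 'o1 \<Rightarrow> 'm1"
    and D :: "('o2, 'm2) cat_data" and N :: "('o2, 'm2) tensor_data" and d :: "'o2 \<Rightarrow> 'o2 \<Rightarrow> 'm2"
    and F :: "('o1, 'm1, 'o2, 'm2) functor_data" and J :: "'o1 \<Rightarrow> 'o1 \<Rightarrow> 'm2" +
  assumes J_braiding: "X \<in> Obj C \<Longrightarrow> Y \<in> Obj C \<Longrightarrow>
      d (FObj F X) (FObj F Y) \<cdot>\<^bsub>D\<^esub> J X Y = J Y X \<cdot>\<^bsub>D\<^esub> FMor F (c X Y)"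


section \<open>Ultraproducts\<close>

text \<open>A set \<open>S\<close> belongs to the (ultra)filter iff \<open>eventually (\<lambda>i. i \<in> S) U\<close>.\<close>

definition ultrafilter :: "'a filter \<Rightarrow> bool" where
  "ultrafilter U \<longleftrightarrow> U \<noteq> bot \<and> (\<forall>P. eventually P U \<or> eventually (\<lambda>i. \<not> P i) U)"

definition ulim :: "nat filter \<Rightarrow> (nat \<Rightarrow> 'a) \<Rightarrow> (nat \<Rightarrow> 'a) set" where
  "ulim U x = {y. \<forall>\<^sub>F i in U. x i = y i}"

text \<open>Terms of a sequence at a negligible set of indices are irrelevant, and termwise operations
  may only be defined for almost every \<open>i\<close>. We therefore admit sequences with \<open>x i \<in> A i\<close> for
  almost every \<open>i\<close>. If no \<open>A i\<close> is empty, these have the same classes as the sequences in the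
  full product, see \<open>ultraproduct_eq_image_Pi\<close> below.\<close>

definition ultraproduct :: "nat filter \<Rightarrow> (nat \<Rightarrow> 'a set) \<Rightarrow> (nat \<Rightarrow> 'a) set set" where
  "ultraproduct U A = {ulim U x | x. \<forall>\<^sub>F i in U. x i \<in> A i}"

text \<open>Each union below is over a family of equal classes, so that \<open>f ([x]) = [f i (x i)]\<close>, see
  \<open>ulift_ulim\<close>, \<open>ulift2_ulim\<close> and \<open>ulift3_ulim\<close>.\<close>

definition ulift :: "nat filter \<Rightarrow> (nat \<Rightarrow> 'a \<Rightarrow> 'b) \<Rightarrow> (nat \<Rightarrow> 'a) set \<Rightarrow> (nat \<Rightarrow> 'b) set" where
  "ulift U f a = (\<Union>x\<in>a. ulim U (\<lambda>i. f i (x i)))"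

definition ulift2 :: "nat filter \<Rightarrow> (nat \<Rightarrow> 'a \<Rightarrow> 'b \<Rightarrow> 'c) \<Rightarrow>
    (nat \<Rightarrow> 'a) set \<Rightarrow> (nat \<Rightarrow> 'b) set \<Rightarrow> (nat \<Rightarrow> 'c) set" where
  "ulift2 U f a b = (\<Union>x\<in>a. \<Union>y\<in>b. ulim U (\<lambda>i. f i (x i) (y i)))"

definition ulift3 :: "nat filter \<Rightarrow> (nat \<Rightarrow> 'a \<Rightarrow> 'b \<Rightarrow> 'c \<Rightarrow> 'd) \<Rightarrow>
    (nat \<Rightarrow> 'a) set \<Rightarrow> (nat \<Rightarrow> 'b) set \<Rightarrow> (nat \<Rightarrow> 'c) set \<Rightarrow> (nat \<Rightarrow> 'd) set" where
  "ulift3 U f a b c = (\<Union>x\<in>a. \<Union>y\<in>b. \<Union>z\<in>c. ulim U (\<lambda>i. f i (x i) (y i) (z i)))"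

lemma ulim_eq_iff: "ulim U x = ulim U y \<longleftrightarrow> (\<forall>\<^sub>F i in U. x i = y i)"
proof
  assume "ulim U x = ulim U y"
  then have "y \<in> ulim U x" by (simp add: ulim_def)
  then show "\<forall>\<^sub>F i in U. x i = y i" by (simp add: ulim_def)
next
  assume *: "\<forall>\<^sub>F i in U. x i = y i"
  have "(\<forall>\<^sub>F i in U. x i = z i) \<longleftrightarrow> (\<forall>\<^sub>F i in U. y i = z i)" for z
    by (rule eventually_cong[OF *]) simp
  then show "ulim U x = ulim U y" by (simp add: ulim_def)
qed

lemma ulim_self: "x \<in> ulim U x"
  by (simp add: ulim_def)

lemma ulift_ulim: "ulift U f (ulim U x) = ulim U (\<lambda>i. f i (x i))"
proof -
  have *: "ulim U (\<lambda>i. f i (x' i)) = ulim U (\<lambda>i. f i (x i))" if "x' \<in> ulim U x" for x'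
    proof -
    have "\<forall>\<^sub>F i in U. x i = x' i"
      using that by (simp add: ulim_def)
    then show ?thesis unfolding ulim_eq_iff by (rule eventually_mono) simp
  qed
  show ?thesis unfolding ulift_def by (intro UN_constant_eq[OF ulim_self] ballI *)
qed

lemma ulift2_ulim: "ulift2 U f (ulim U x) (ulim U y) = ulim U (\<lambda>i. f i (x i) (y i))"
proof -
  have *: "ulim U (\<lambda>i. f i (x' i) (y' i)) = ulim U (\<lambda>i. f i (x i) (y i))"
    if "x' \<in> ulim U x" "y' \<in> ulim U y" for x' y'
    proof -
    have "\<forall>\<^sub>F i in U. x i = x' i \<and> y i = y' i"
      using that by (simp add: ulim_def eventually_conj_iff)
    then show ?thesis unfolding ulim_eq_iff by (rule eventually_mono) simp
  qed
  show ?thesis unfolding ulift2_def by (intro UN_constant_eq[OF ulim_self] ballI *)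
qed

lemma ulift3_ulim:
  "ulift3 U f (ulim U x) (ulim U y) (ulim U z) = ulim U (\<lambda>i. f i (x i) (y i) (z i))"
proof -
  have *: "ulim U (\<lambda>i. f i (x' i) (y' i) (z' i)) = ulim U (\<lambda>i. f i (x i) (y i) (z i))"
    if "x' \<in> ulim U x" "y' \<in> ulim U y" "z' \<in> ulim U z" for x' y' z'
  proof -
    have "\<forall>\<^sub>F i in U. x i = x' i \<and> y i = y' i \<and> z i = z' i"
      using that by (simp add: ulim_def eventually_conj_iff)
    then show ?thesis unfolding ulim_eq_iff by (rule eventually_mono) simp
  qed
  show ?thesis unfolding ulift3_def by (intro UN_constant_eq[OF ulim_self] ballI *)
qed

lemma ultraproduct_eq_image_Pi:
  assumes "\<And>i. A i \<noteq> {}"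
  shows "ultraproduct U A = ulim U ` {x. \<forall>i. x i \<in> A i}"
proof
  show "ultraproduct U A \<subseteq> ulim U ` {x. \<forall>i. x i \<in> A i}"
  proof
    fix a assume "a \<in> ultraproduct U A"
    then obtain x where x: "a = ulim U x" "\<forall>\<^sub>F i in U. x i \<in> A i"
      by (auto simp: ultraproduct_def)
    define y where "y i = (if x i \<in> A i then x i else (SOME u. u \<in> A i))" for i
    have "\<forall>i. y i \<in> A i" using assms by (simp add: y_def some_in_eq)
    moreover have "a = ulim U y"
      unfolding x(1) ulim_eq_iff by (rule eventually_mono[OF x(2)]) (simp add: y_def)
    ultimately show "a \<in> ulim U ` {x. \<forall>i. x i \<in> A i}" by blast
  qed
qed (auto simp: ultraproduct_def)

definition ultraproduct_category ::
  "nat filter \<Rightarrow> (nat \<Rightarrow> ('o, 'm) cat_data) \<Rightarrow> ((nat \<Rightarrow> 'o) set, (nat \<Rightarrow> 'm) set) cat_data" where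
  "ultraproduct_category U C =
    \<lparr>Obj = ultraproduct U (\<lambda>i. Obj (C i)),
     Mor = ultraproduct U (\<lambda>i. Mor (C i)),
     Dom = ulift U (\<lambda>i. Dom (C i)),
     Cod = ulift U (\<lambda>i. Cod (C i)),
     Ident = ulift U (\<lambda>i. Ident (C i)),
     Comp = ulift2 U (\<lambda>i. Comp (C i))\<rparr>"

definition ultraproduct_functor ::
  "nat filter \<Rightarrow> (nat \<Rightarrow> ('o1, 'm1, 'o2, 'm2) functor_data) \<Rightarrow>
    ((nat \<Rightarrow> 'o1) set, (nat \<Rightarrow> 'm1) set, (nat \<Rightarrow> 'o2) set, (nat \<Rightarrow> 'm2) set) functor_data" where
  "ultraproduct_functor U F =
    \<lparr>FObj = ulift U (\<lambda>i. FObj (F i)), FMor = ulift U (\<lambda>i. FMor (F i))\<rparr>"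

definition ultraproduct_tensor ::
  "nat filter \<Rightarrow> (nat \<Rightarrow> ('o, 'm) tensor_data) \<Rightarrow> ((nat \<Rightarrow> 'o) set, (nat \<Rightarrow> 'm) set) tensor_data" where
  "ultraproduct_tensor U M =
    \<lparr>TObj = ulift2 U (\<lambda>i. TObj (M i)),
     TMor = ulift2 U (\<lambda>i. TMor (M i)),
     TUnit = ulim U (\<lambda>i. TUnit (M i)),
     Assoc = ulift3 U (\<lambda>i. Assoc (M i)),
     LUnit = ulift U (\<lambda>i. LUnit (M i)),
     RUnit = ulift U (\<lambda>i. RUnit (M i))\<rparr>"

end

theory Submission
  imports Defs
begin

text \<open>
  The argument is the special case of Los's theorem for Horn clauses. Every object and morphism
  of an ultraproduct category is the class of a sequence, all operations act termwise on
  representatives, and equality of classes, membership in the carriers, in a hom-set and among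
  the isomorphisms all mean that the corresponding statement holds for almost every index
  (lemmas \<open>ulim_eq_iff\<close>, \<open>Hom_ultraproduct_iff\<close>, \<open>Isos_ultraproduct_iff\<close>). Almost every axiom of a
  category, a functor, a monoidal or braided category, or a monoidal or braided functor is a Horn
  clause in such atoms: finitely many premises that hold almost everywhere imply, at every index
  where moreover the factor satisfies the axiom, the conclusion, which therefore holds almost
  everywhere.

  Two points go beyond Horn clauses. Invertibility of a morphism and the existence of an isomorphism
  \<open>F(\<one>) \<cong> \<one>\<close> are existential statements, so a sequence of witnesses has to be chosen
  (\<open>eventually_choice_iff\<close>). The second hexagon mentions inverses of associators, which are
  computed termwise because inverses in a category are unique (\<open>inv_mor_ultraproduct\<close>).
\<close>

section \<open>Classes of sequences\<close>

lemma ulim_in_ultraproduct [simp]: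
  "ulim U x \<in> ultraproduct U A \<longleftrightarrow> (\<forall>\<^sub>F i in U. x i \<in> A i)"
proof
  assume "ulim U x \<in> ultraproduct U A"
  then obtain y where "\<forall>\<^sub>F i in U. x i = y i" "\<forall>\<^sub>F i in U. y i \<in> A i"
    by (auto simp: ultraproduct_def ulim_eq_iff)
  then show "\<forall>\<^sub>F i in U. x i \<in> A i"
    by eventually_elim simp
qed (auto simp: ultraproduct_def)

lemma eventually_choice_iff:
  "(\<exists>y. \<forall>\<^sub>F i in U. P i (y i)) \<longleftrightarrow> (\<forall>\<^sub>F i in U. \<exists>z. P i z)"
proof
  assume "\<forall>\<^sub>F i in U. \<exists>z. P i z"
  then have "\<forall>\<^sub>F i in U. P i (SOME z. P i z)"
    by eventually_elim (rule someI_ex)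
  then show "\<exists>y. \<forall>\<^sub>F i in U. P i (y i)"
    by (rule exI[of _ "\<lambda>i. SOME z. P i z"])
qed (auto elim: eventually_mono)

section \<open>Inverses in a category\<close>

lemma (in category) inverse_mor_unique:
  assumes "inverse_mor C f g" "inverse_mor C f h"
  shows "g = h"
proof -
  have f: "f \<in> Hom C (Dom C f) (Cod C f)"
    using assms by (simp add: inverse_mor_def Hom_def)
  have g: "g \<in> Hom C (Cod C f) (Dom C f)" and h: "h \<in> Hom C (Cod C f) (Dom C f)"
    using assms by (simp_all add: inverse_mor_def)
  have "g = g \<cdot>\<^bsub>C\<^esub> Ident C (Cod C f)"
    using Comp_Ident[OF g] by simp
  also have "\<dots> = (g \<cdot>\<^bsub>C\<^esub> f) \<cdot>\<^bsub>C\<^esub> h"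
    using assms(2) Comp_assoc[OF h f g] by (simp add: inverse_mor_def)
  also have "\<dots> = h"
    using assms(1) Ident_Comp[OF h] by (simp add: inverse_mor_def)
  finally show ?thesis .
qed

lemma (in category) inv_mor_eqI: "inverse_mor C f g \<Longrightarrow> inv_mor C f = g"
  unfolding inv_mor_def by (blast intro: inverse_mor_unique)

context
  fixes U :: "nat filter"
begin

section \<open>Termwise description of ultraproduct categories\<close>

lemma Obj_ultraproduct_iff [simp]:
  "ulim U X \<in> Obj (ultraproduct_category U C) \<longleftrightarrow> (\<forall>\<^sub>F i in U. X i \<in> Obj (C i))"
  by (simp add: ultraproduct_category_def)

lemma Mor_ultraproduct_iff [simp]:
  "ulim U f \<in> Mor (ultraproduct_category U C) \<longleftrightarrow> (\<forall>\<^sub>F i in U. f i \<in> Mor (C i))"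
  by (simp add: ultraproduct_category_def)

lemma ultraproduct_category_ulim [simp]:
  "Dom (ultraproduct_category U C) (ulim U f) = ulim U (\<lambda>i. Dom (C i) (f i))"
  "Cod (ultraproduct_category U C) (ulim U f) = ulim U (\<lambda>i. Cod (C i) (f i))"
  "Ident (ultraproduct_category U C) (ulim U X) = ulim U (\<lambda>i. Ident (C i) (X i))"
  "ulim U g \<cdot>\<^bsub>ultraproduct_category U C\<^esub> ulim U f = ulim U (\<lambda>i. g i \<cdot>\<^bsub>C i\<^esub> f i)"
  by (simp_all add: ultraproduct_category_def ulift_ulim ulift2_ulim)

lemma ultraproduct_functor_ulim [simp]:
  "FObj (ultraproduct_functor U F) (ulim U X) = ulim U (\<lambda>i. FObj (F i) (X i))"
  "FMor (ultraproduct_functor U F) (ulim U f) = ulim U (\<lambda>i. FMor (F i) (f i))"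
  by (simp_all add: ultraproduct_functor_def ulift_ulim)

lemma ultraproduct_tensor_ulim [simp]:
  "ulim U X \<otimes>\<^bsub>ultraproduct_tensor U M\<^esub> ulim U Y = ulim U (\<lambda>i. X i \<otimes>\<^bsub>M i\<^esub> Y i)"
  "ulim U f \<boxtimes>\<^bsub>ultraproduct_tensor U M\<^esub> ulim U g = ulim U (\<lambda>i. f i \<boxtimes>\<^bsub>M i\<^esub> g i)"
  "\<one>\<^bsub>ultraproduct_tensor U M\<^esub> = ulim U (\<lambda>i. \<one>\<^bsub>M i\<^esub>)"
  "Assoc (ultraproduct_tensor U M) (ulim U X) (ulim U Y) (ulim U Z) =
     ulim U (\<lambda>i. Assoc (M i) (X i) (Y i) (Z i))"
  "LUnit (ultraproduct_tensor U M) (ulim U X) = ulim U (\<lambda>i. LUnit (M i) (X i))"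
  "RUnit (ultraproduct_tensor U M) (ulim U X) = ulim U (\<lambda>i. RUnit (M i) (X i))"
  by (simp_all add: ultraproduct_tensor_def ulift_ulim ulift2_ulim ulift3_ulim)

lemma Hom_ultraproduct_iff [simp]:
  "ulim U f \<in> Hom (ultraproduct_category U C) (ulim U X) (ulim U Y) \<longleftrightarrow>
     (\<forall>\<^sub>F i in U. f i \<in> Hom (C i) (X i) (Y i))"
  by (simp add: Hom_def ulim_eq_iff eventually_conj_iff)

lemma inverse_mor_ultraproduct_iff [simp]:
  "inverse_mor (ultraproduct_category U C) (ulim U f) (ulim U g) \<longleftrightarrow>
     (\<forall>\<^sub>F i in U. inverse_mor (C i) (f i) (g i))"
  by (simp add: inverse_mor_def ulim_eq_iff eventually_conj_iff)

lemma Obj_ultraproductE: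
  assumes "A \<in> Obj (ultraproduct_category U C)"
  obtains X where "A = ulim U X" "\<forall>\<^sub>F i in U. X i \<in> Obj (C i)"
  using assms by (auto simp: ultraproduct_category_def ultraproduct_def)

lemma Mor_ultraproductE:
  assumes "a \<in> Mor (ultraproduct_category U C)"
  obtains f where "a = ulim U f" "\<forall>\<^sub>F i in U. f i \<in> Mor (C i)"
  using assms by (auto simp: ultraproduct_category_def ultraproduct_def)

text \<open>The representatives of source and target are taken to be the termwise source and target of
  the representative of the morphism.\<close>

lemma Hom_ultraproductE:
  assumes "a \<in> Hom (ultraproduct_category U C) A B"
  obtains f X Y where "a = ulim U f" "A = ulim U X" "B = ulim U Y"
    "\<forall>\<^sub>F i in U. f i \<in> Hom (C i) (X i) (Y i)"
proof -
  have "a \<in> Mor (ultraproduct_category U C)"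
    using assms by (simp add: Hom_def)
  then obtain f where f: "a = ulim U f" "\<forall>\<^sub>F i in U. f i \<in> Mor (C i)"
    by (rule Mor_ultraproductE)
  show thesis
  proof
    show "A = ulim U (\<lambda>i. Dom (C i) (f i))" "B = ulim U (\<lambda>i. Cod (C i) (f i))"
      using assms f(1) by (auto simp: Hom_def)
    show "\<forall>\<^sub>F i in U. f i \<in> Hom (C i) (Dom (C i) (f i)) (Cod (C i) (f i))"
      using f(2) by (simp add: Hom_def)
  qed (rule f(1))
qed

text \<open>From right to left, termwise inverses are chosen; from left to right, a representative of the
  inverse consists of inverses almost everywhere. No category axiom is involved.\<close>

lemma Isos_ultraproduct_iff [simp]:
  "ulim U f \<in> Isos (ultraproduct_category U C) (ulim U X) (ulim U Y) \<longleftrightarrow>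
     (\<forall>\<^sub>F i in U. f i \<in> Isos (C i) (X i) (Y i))"
proof -
  have "(\<exists>b. inverse_mor (ultraproduct_category U C) (ulim U f) b) \<longleftrightarrow>
      (\<exists>g. inverse_mor (ultraproduct_category U C) (ulim U f) (ulim U g))"
    unfolding inverse_mor_def by (blast elim: Hom_ultraproductE)
  then show ?thesis
    by (simp add: Isos_def eventually_conj_iff
        eventually_choice_iff[where P = "\<lambda>i. inverse_mor (C i) (f i)"])
qed

section \<open>Transfer of the axioms\<close>

text \<open>Apart from the isomorphism \<open>F(\<one>) \<cong> \<one>\<close>, every axiom follows one pattern.
  Representatives are substituted for all objects and morphisms, the termwise descriptions turn
  hypotheses and goal into statements of the form
  \<open>\<forall>\<^sub>F i in U. P i\<close>, and \<open>eventually_rev_mp\<close> moves the hypotheses under the quantifier; what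
  remains is the axiom at a single index. For axioms about composable morphisms the common object has
  two representatives, which agree almost everywhere, so the last step also rewrites with
  this equality.\<close>

lemma category_ultraproduct:
  assumes cat: "\<forall>\<^sub>F i in U. category (C i)"
  shows "category (ultraproduct_category U C)"
proof (intro category.intro,
    goal_cases Dom_in Cod_in Ident_in Comp_in Ident_Comp Comp_Ident Comp_assoc)
  case (Dom_in a)
  then show ?case using cat
    by (elim Mor_ultraproductE) (simp, elim eventually_rev_mp,
      intro always_eventually allI impI, rule category.Dom_in)
next
  case (Cod_in a)
  then show ?case using cat
    by (elim Mor_ultraproductE) (simp, elim eventually_rev_mp,
      intro always_eventually allI impI, rule category.Cod_in)
next
  case (Ident_in A)
  then show ?case using cat
    by (elim Obj_ultraproductE) (simp, elim eventually_rev_mp,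
      intro always_eventually allI impI, rule category.Ident_in)
next
  case (Comp_in a A B b Z)
  then show ?case using cat
    by (elim Hom_ultraproductE) (simp add: ulim_eq_iff, elim eventually_rev_mp,
      intro always_eventually allI impI, simp add: category.Comp_in)
next
  case (Ident_Comp a A B)
  then show ?case using cat
    by (elim Hom_ultraproductE) (simp add: ulim_eq_iff, elim eventually_rev_mp,
      intro always_eventually allI impI, rule category.Ident_Comp)
next
  case (Comp_Ident a A B)
  then show ?case using cat
    by (elim Hom_ultraproductE) (simp add: ulim_eq_iff, elim eventually_rev_mp,
      intro always_eventually allI impI, rule category.Comp_Ident)
next
  case (Comp_assoc a A B b Z c W)
  then show ?case using cat
    by (elim Hom_ultraproductE) (simp add: ulim_eq_iff, elim eventually_rev_mp,
      intro always_eventually allI impI, simp add: category.Comp_assoc)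
qed

lemma cat_functor_ultraproduct:
  assumes fn: "\<forall>\<^sub>F i in U. cat_functor (C i) (D i) (F i)"
  shows "cat_functor (ultraproduct_category U C) (ultraproduct_category U D) (ultraproduct_functor U F)"
proof (intro cat_functor.intro cat_functor_axioms.intro category_ultraproduct,
    goal_cases C D FObj_in FMor_in FMor_Ident FMor_Comp)
  case C
  show ?case using fn by eventually_elim (rule cat_functor.axioms(1))
next
  case D
  show ?case using fn by eventually_elim (rule cat_functor.axioms(2))
next
  case (FObj_in A)
  then show ?case using fn
    by (elim Obj_ultraproductE) (simp add: ulim_eq_iff, elim eventually_rev_mp,
      intro always_eventually allI impI, rule cat_functor.FObj_in)
next
  case (FMor_in a A B)
  then show ?case using fn
    by (elim Hom_ultraproductE) (simp add: ulim_eq_iff, elim eventually_rev_mp,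
      intro always_eventually allI impI, rule cat_functor.FMor_in)
next
  case (FMor_Ident A)
  then show ?case using fn
    by (elim Obj_ultraproductE) (simp add: ulim_eq_iff, elim eventually_rev_mp,
      intro always_eventually allI impI, rule cat_functor.FMor_Ident)
next
  case (FMor_Comp a A B b Z)
  then show ?case using fn
    by (elim Hom_ultraproductE) (simp add: ulim_eq_iff, elim eventually_rev_mp,
      intro always_eventually allI impI, simp add: cat_functor.FMor_Comp)
qed

lemma monoidal_category_ultraproduct:
  assumes mon: "\<forall>\<^sub>F i in U. monoidal_category (C i) (M i)"
  shows "monoidal_category (ultraproduct_category U C) (ultraproduct_tensor U M)"
proof (intro monoidal_category.intro monoidal_category_axioms.intro category_ultraproduct,
    goal_cases C TObj_in TMor_in TMor_Ident TMor_Comp TUnit_in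
      Assoc_iso Assoc_natural
      LUnit_iso LUnit_natural RUnit_iso RUnit_natural pentagon triangle)
  case C
  show ?case using mon by eventually_elim (rule monoidal_category.axioms(1))
next
  case (TObj_in A B)
  then show ?case using mon
    by (elim Obj_ultraproductE) (simp add: ulim_eq_iff, elim eventually_rev_mp,
      intro always_eventually allI impI, rule monoidal_category.TObj_in)
next
  case (TMor_in a A A' b B B')
  then show ?case using mon
    by (elim Hom_ultraproductE) (simp add: ulim_eq_iff, elim eventually_rev_mp,
      intro always_eventually allI impI, rule monoidal_category.TMor_in)
next
  case (TMor_Ident A B)
  then show ?case using mon
    by (elim Obj_ultraproductE) (simp add: ulim_eq_iff, elim eventually_rev_mp,
      intro always_eventually allI impI, rule monoidal_category.TMor_Ident)
next
  case (TMor_Comp a A A' a' A'' b B B' b' B'')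
  then show ?case using mon
    by (elim Hom_ultraproductE) (simp add: ulim_eq_iff, elim eventually_rev_mp,
      intro always_eventually allI impI, simp add: monoidal_category.TMor_Comp)
next
  case TUnit_in
  then show ?case using mon
    by (simp add: ulim_eq_iff, elim eventually_rev_mp,
      intro always_eventually allI impI, simp add: monoidal_category.TUnit_in)
next
  case (Assoc_iso A B Z)
  then show ?case using mon
    by (elim Obj_ultraproductE) (simp add: ulim_eq_iff, elim eventually_rev_mp,
      intro always_eventually allI impI, rule monoidal_category.Assoc_iso)
next
  case (Assoc_natural a A A' b B B' c Z Z')
  then show ?case using mon
    by (elim Hom_ultraproductE) (simp add: ulim_eq_iff, elim eventually_rev_mp,
      intro always_eventually allI impI, rule monoidal_category.Assoc_natural)
next
  case (LUnit_iso A)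
  then show ?case using mon
    by (elim Obj_ultraproductE) (simp add: ulim_eq_iff, elim eventually_rev_mp,
      intro always_eventually allI impI, rule monoidal_category.LUnit_iso)
next
  case (LUnit_natural a A A')
  then show ?case using mon
    by (elim Hom_ultraproductE) (simp add: ulim_eq_iff, elim eventually_rev_mp,
      intro always_eventually allI impI, rule monoidal_category.LUnit_natural)
next
  case (RUnit_iso A)
  then show ?case using mon
    by (elim Obj_ultraproductE) (simp add: ulim_eq_iff, elim eventually_rev_mp,
      intro always_eventually allI impI, rule monoidal_category.RUnit_iso)
next
  case (RUnit_natural a A A')
  then show ?case using mon
    by (elim Hom_ultraproductE) (simp add: ulim_eq_iff, elim eventually_rev_mp,
      intro always_eventually allI impI, rule monoidal_category.RUnit_natural)
next
  case (pentagon W A B Z)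
  then show ?case using mon
    by (elim Obj_ultraproductE) (simp add: ulim_eq_iff, elim eventually_rev_mp,
      intro always_eventually allI impI, rule monoidal_category.pentagon)
next
  case (triangle A B)
  then show ?case using mon
    by (elim Obj_ultraproductE) (simp add: ulim_eq_iff, elim eventually_rev_mp,
      intro always_eventually allI impI, rule monoidal_category.triangle)
qed

text \<open>The category axioms enter through the uniqueness of inverses, in the factors and in the
  ultraproduct.\<close>

lemma inv_mor_ultraproduct:
  assumes cat: "\<forall>\<^sub>F i in U. category (C i)"
    and iso: "\<forall>\<^sub>F i in U. f i \<in> Isos (C i) (X i) (Y i)"
  shows "inv_mor (ultraproduct_category U C) (ulim U f) = ulim U (\<lambda>i. inv_mor (C i) (f i))"
proof -
  have "\<forall>\<^sub>F i in U. inverse_mor (C i) (f i) (inv_mor (C i) (f i))"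
    using cat iso by eventually_elim (auto simp: Isos_def category.inv_mor_eqI)
  then show ?thesis
    by (intro category.inv_mor_eqI category_ultraproduct cat) simp
qed

lemma braided_category_ultraproduct:
  assumes br: "\<forall>\<^sub>F i in U. braided_category (C i) (M i) (c i)"
  shows "braided_category (ultraproduct_category U C) (ultraproduct_tensor U M) (ulift2 U c)"
proof (intro braided_category.intro braided_category_axioms.intro monoidal_category_ultraproduct,
    goal_cases M braiding_iso braiding_natural hexagon1 hexagon2)
  case M
  show ?case using br by eventually_elim (rule braided_category.axioms(1))
next
  case (braiding_iso A B)
  then show ?case using br
    by (elim Obj_ultraproductE)
      (simp add: ulim_eq_iff ulift2_ulim, elim eventually_rev_mp,
        intro always_eventually allI impI, rule braided_category.braiding_iso)
next
  case (braiding_natural a A A' b B B')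
  then show ?case using br
    by (elim Hom_ultraproductE)
      (simp add: ulim_eq_iff ulift2_ulim, elim eventually_rev_mp,
        intro always_eventually allI impI, rule braided_category.braiding_natural)
next
  case (hexagon1 A B Z)
  then show ?case using br
    by (elim Obj_ultraproductE)
      (simp add: ulim_eq_iff ulift2_ulim, elim eventually_rev_mp,
        intro always_eventually allI impI, rule braided_category.hexagon1)
next
  case (hexagon2 A B Z)
  have mon: "\<forall>\<^sub>F i in U. monoidal_category (C i) (M i)"
    using br by eventually_elim (rule braided_category.axioms(1))
  then have cat: "\<forall>\<^sub>F i in U. category (C i)"
    by eventually_elim (rule monoidal_category.axioms(1))
  have inv_Assoc: "inv_mor (ultraproduct_category U C) (ulim U (\<lambda>i. Assoc (M i) (X i) (Y i) (Z i))) =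
      ulim U (\<lambda>i. inv_mor (C i) (Assoc (M i) (X i) (Y i) (Z i)))"
    if "\<forall>\<^sub>F i in U. X i \<in> Obj (C i)" "\<forall>\<^sub>F i in U. Y i \<in> Obj (C i)" "\<forall>\<^sub>F i in U. Z i \<in> Obj (C i)"
    for X Y Z
  proof (rule inv_mor_ultraproduct[OF cat])
    show "\<forall>\<^sub>F i in U. Assoc (M i) (X i) (Y i) (Z i) \<in>
        Isos (C i) ((X i \<otimes>\<^bsub>M i\<^esub> Y i) \<otimes>\<^bsub>M i\<^esub> Z i) (X i \<otimes>\<^bsub>M i\<^esub> (Y i \<otimes>\<^bsub>M i\<^esub> Z i))"
      using mon that by eventually_elim (rule monoidal_category.Assoc_iso)
  qed
  show ?case using hexagon2 br
    by (elim Obj_ultraproductE) (simp add: ulim_eq_iff ulift2_ulim inv_Assoc,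
      elim eventually_rev_mp, intro always_eventually allI impI, rule braided_category.hexagon2)
qed

lemma monoidal_functor_ultraproduct:
  assumes mon: "\<forall>\<^sub>F i in U. monoidal_functor (C i) (M i) (D i) (N i) (F i) (J i)"
  shows "monoidal_functor (ultraproduct_category U C) (ultraproduct_tensor U M)
    (ultraproduct_category U D) (ultraproduct_tensor U N) (ultraproduct_functor U F) (ulift2 U J)"
proof (intro monoidal_functor.intro monoidal_functor_axioms.intro
    cat_functor_ultraproduct monoidal_category_ultraproduct,
    goal_cases F C D J_iso J_natural J_assoc F_unit)
  case F
  show ?case using mon by eventually_elim (rule monoidal_functor.axioms(1))
next
  case C
  show ?case using mon by eventually_elim (rule monoidal_functor.axioms(2))
next
  case D
  show ?case using mon by eventually_elim (rule monoidal_functor.axioms(3))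
next
  case (J_iso A B)
  then show ?case using mon
    by (elim Obj_ultraproductE)
      (simp add: ulim_eq_iff ulift2_ulim, elim eventually_rev_mp,
        intro always_eventually allI impI, rule monoidal_functor.J_iso)
next
  case (J_natural a A A' b B B')
  then show ?case using mon
    by (elim Hom_ultraproductE)
      (simp add: ulim_eq_iff ulift2_ulim, elim eventually_rev_mp,
        intro always_eventually allI impI, rule monoidal_functor.J_natural)
next
  case (J_assoc A B Z)
  then show ?case using mon
    by (elim Obj_ultraproductE)
      (simp add: ulim_eq_iff ulift2_ulim, elim eventually_rev_mp,
        intro always_eventually allI impI, rule monoidal_functor.J_assoc)
next
  case F_unit
  \<comment> \<open>A sequence of termwise isomorphisms represents an isomorphism between the units.\<close>
  have "\<forall>\<^sub>F i in U. \<exists>u. u \<in> Isos (D i) (FObj (F i) \<one>\<^bsub>M i\<^esub>) \<one>\<^bsub>N i\<^esub>"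
    using mon by eventually_elim (use monoidal_functor.F_unit in blast)
  then obtain u where "\<forall>\<^sub>F i in U. u i \<in> Isos (D i) (FObj (F i) \<one>\<^bsub>M i\<^esub>) \<one>\<^bsub>N i\<^esub>"
    by (auto simp flip: eventually_choice_iff)
  then have "ulim U u \<in> Isos (ultraproduct_category U D)
      (FObj (ultraproduct_functor U F) \<one>\<^bsub>ultraproduct_tensor U M\<^esub>) \<one>\<^bsub>ultraproduct_tensor U N\<^esub>"
    by simp
  then show ?case by blast
qed

lemma braided_functor_ultraproduct:
  assumes br: "\<forall>\<^sub>F i in U. braided_functor (C i) (M i) (c i) (D i) (N i) (d i) (F i) (J i)"
  shows "braided_functor (ultraproduct_category U C) (ultraproduct_tensor U M) (ulift2 U c)
    (ultraproduct_category U D) (ultraproduct_tensor U N) (ulift2 U d) (ultraproduct_functor U F) (ulift2 U J)"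
proof (intro braided_functor.intro braided_functor_axioms.intro
    monoidal_functor_ultraproduct braided_category_ultraproduct,
    goal_cases F C D J_braiding)
  case F
  show ?case using br by eventually_elim (rule braided_functor.axioms(1))
next
  case C
  show ?case using br by eventually_elim (rule braided_functor.axioms(2))
next
  case D
  show ?case using br by eventually_elim (rule braided_functor.axioms(3))
next
  case (J_braiding A B)
  then show ?case using br
    by (elim Obj_ultraproductE)
      (simp add: ulim_eq_iff ulift2_ulim, elim eventually_rev_mp,
        intro always_eventually allI impI, rule braided_functor.J_braiding)
qed

end

theorem propositionA27:
  fixes U :: "nat filter"
    and C :: "nat \<Rightarrow> ('o1, 'm1) cat_data"
    and D :: "nat \<Rightarrow> ('o2, 'm2) cat_data"
    and F :: "nat \<Rightarrow> ('o1, 'm1, 'o2, 'm2) functor_data"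
  assumes "ultrafilter U"
    and "\<And>i. cat_functor (C i) (D i) (F i)"
  shows
    "(\<forall>X X'. (\<forall>\<^sub>F i in U. X i \<in> Obj (C i)) \<and> (\<forall>\<^sub>F i in U. X' i \<in> Obj (C i)) \<and> ulim U X = ulim U X' \<longrightarrow>
        ulim U (\<lambda>i. FObj (F i) (X i)) = ulim U (\<lambda>i. FObj (F i) (X' i))) \<and>
     (\<forall>f f'. (\<forall>\<^sub>F i in U. f i \<in> Mor (C i)) \<and> (\<forall>\<^sub>F i in U. f' i \<in> Mor (C i)) \<and> ulim U f = ulim U f' \<longrightarrow>
        ulim U (\<lambda>i. FMor (F i) (f i)) = ulim U (\<lambda>i. FMor (F i) (f' i))) \<and>
     (\<forall>X. (\<forall>\<^sub>F i in U. X i \<in> Obj (C i)) \<longrightarrow>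
        FObj (ultraproduct_functor U F) (ulim U X) = ulim U (\<lambda>i. FObj (F i) (X i))) \<and>
     (\<forall>f. (\<forall>\<^sub>F i in U. f i \<in> Mor (C i)) \<longrightarrow>
        FMor (ultraproduct_functor U F) (ulim U f) = ulim U (\<lambda>i. FMor (F i) (f i))) \<and>
     cat_functor (ultraproduct_category U C) (ultraproduct_category U D) (ultraproduct_functor U F) \<and>
     (\<forall>M N J. (\<forall>\<^sub>F i in U. monoidal_functor (C i) (M i) (D i) (N i) (F i) (J i)) \<longrightarrow>
        monoidal_functor
          (ultraproduct_category U C) (ultraproduct_tensor U M)
          (ultraproduct_category U D) (ultraproduct_tensor U N)
          (ultraproduct_functor U F) (ulift2 U J)) \<and>
     (\<forall>M c N d J. (\<forall>\<^sub>F i in U. braided_functor (C i) (M i) (c i) (D i) (N i) (d i) (F i) (J i)) \<longrightarrow>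
        braided_functor
          (ultraproduct_category U C) (ultraproduct_tensor U M) (ulift2 U c)
          (ultraproduct_category U D) (ultraproduct_tensor U N) (ulift2 U d)
          (ultraproduct_functor U F) (ulift2 U J))"
proof (intro conjI allI impI; (elim conjE)?)
  show "cat_functor (ultraproduct_category U C) (ultraproduct_category U D) (ultraproduct_functor U F)"
    by (intro cat_functor_ultraproduct always_eventually allI assms(2))
qed (auto simp: ulim_eq_iff elim: eventually_mono
    intro: monoidal_functor_ultraproduct braided_functor_ultraproduct)

end
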